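(* For every integer $n \geq 5$, Left wins the Classic Variant of the Mixed Deletion Game played on the path $P_n$ regardless of which player moves first (i.e. $P_n > 0$ as a game).
   Context: The Classic Variant of the Mixed Deletion Game is a two-player combinatorial game between Left and Right played on a finite simple undirected graph; players alternate turns. On her turn Left deletes one vertex together with all edges incident to it; on his turn Right deletes one edge. The game ends when a deletion creates an isolated vertex (a vertex of degree $0$), and the player whose deletion created an isolated vertex loses; thus a legal move is a deletion which does not create an isolated vertex, and a player with no legal move loses. $P_n$ denotes the path graph on $n$ vertices. *)

theory Defs
  imports Main
begin

datatype 'a graph = Graph (verts: "'a set") (edges: "'a set set")

definition simple_graph :: "'a graph \<Rightarrow> bool" where
  "simple_graph G \<longleftrightarrow> finite (verts G) \<and> (\<forall>e\<in>edges G. e \<subseteq> verts G \<and> card e = 2)"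

definition degree :: "'a graph \<Rightarrow> 'a \<Rightarrow> nat" where
  "degree G v = card {e \<in> edges G. v \<in> e}"

definition isolated :: "'a graph \<Rightarrow> 'a \<Rightarrow> bool" where
  "isolated G v \<longleftrightarrow> v \<in> verts G \<and> degree G v = 0"

definition delete_vertex :: "'a graph \<Rightarrow> 'a \<Rightarrow> 'a graph" where
  "delete_vertex G v = Graph (verts G - {v}) {e \<in> edges G. v \<notin> e}"

definition delete_edge :: "'a graph \<Rightarrow> 'a set \<Rightarrow> 'a graph" where
  "delete_edge G e = Graph (verts G) (edges G - {e})"

definition creates_isolated :: "'a graph \<Rightarrow> 'a graph \<Rightarrow> bool" where
  "creates_isolated G H \<longleftrightarrow> (\<exists>v. isolated H v \<and> \<not> isolated G v)"

datatype player = Left | Right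

fun opponent :: "player \<Rightarrow> player" where
  "opponent Left = Right"
| "opponent Right = Left"

fun deletions :: "player \<Rightarrow> 'a graph \<Rightarrow> 'a graph set" where
  "deletions Left G = delete_vertex G ` verts G"
| "deletions Right G = delete_edge G ` edges G"

definition legal_moves :: "player \<Rightarrow> 'a graph \<Rightarrow> 'a graph set" where
  "legal_moves p G = {H \<in> deletions p G. \<not> creates_isolated G H}"

text \<open>\<open>wins w p G\<close>: player \<open>w\<close> can force a win from position \<open>G\<close> when \<open>p\<close> is to move.
  The second rule includes the case in which the opponent is to move and has no legal move;
  a player \<open>w\<close> to move without a legal move is covered by neither rule and so does not win.\<close>

inductive wins :: "player \<Rightarrow> player \<Rightarrow> 'a graph \<Rightarrow> bool" for w :: player where
  own_turn: "\<exists>H\<in>legal_moves w G. wins w (opponent w) H \<Longrightarrow> wins w w G"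
| opponent_turn: "\<forall>H\<in>legal_moves (opponent w) G. wins w w H \<Longrightarrow> wins w (opponent w) G"

definition path_graph :: "nat \<Rightarrow> nat graph" where
  "path_graph n = Graph {0..<n} {{i, Suc i} | i. Suc i < n}"

lemma simple_graph_path_graph: "simple_graph (path_graph n)"
  by (auto simp: simple_graph_def path_graph_def)

lemma simple_graph_legal_move:
  assumes "simple_graph G" "H \<in> legal_moves p G"
  shows "simple_graph H"
  using assms
  by (cases p; fastforce simp: simple_graph_def legal_moves_def delete_vertex_def delete_edge_def)

text \<open>On finite graphs play always ends, and the rules above determine exactly one winner.\<close>

lemma wins_own: "wins w w G \<longleftrightarrow> (\<exists>H\<in>legal_moves w G. wins w (opponent w) H)"
  by (cases w; subst wins.simps) auto

lemma wins_opponent: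
  "wins w (opponent w) G \<longleftrightarrow> (\<forall>H\<in>legal_moves (opponent w) G. wins w w H)"
  by (cases w; subst wins.simps) auto

lemma legal_move_smaller:
  assumes "simple_graph G" "H \<in> legal_moves p G"
  shows "card (verts H) + card (edges H) < card (verts G) + card (edges G)"
proof -
  have fV: "finite (verts G)" and "edges G \<subseteq> Pow (verts G)"
    using assms(1) by (auto simp: simple_graph_def)
  then have fE: "finite (edges G)"
    using finite_subset by blast
  show ?thesis
  proof (cases p)
    case Left
    then obtain v where "v \<in> verts G" "H = delete_vertex G v"
      using assms(2) by (auto simp: legal_moves_def)
    moreover have "card {e \<in> edges G. v \<notin> e} \<le> card (edges G)"
      using fE by (intro card_mono) auto
    ultimately show ?thesis
      using fV card_Diff1_less[of "verts G" v] by (auto simp: delete_vertex_def)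
  next
    case Right
    then obtain e where "e \<in> edges G" "H = delete_edge G e"
      using assms(2) by (auto simp: legal_moves_def)
    then show ?thesis
      using fE card_Diff1_less[of "edges G" e] by (auto simp: delete_edge_def)
  qed
qed

lemma wins_determined:
  assumes "simple_graph G"
  shows "wins Left p G \<longleftrightarrow> \<not> wins Right p G"
  using assms
proof (induction "card (verts G) + card (edges G)" arbitrary: G p rule: less_induct)
  case less
  have IH: "wins Left q H \<longleftrightarrow> \<not> wins Right q H" if "H \<in> legal_moves p G" for q H
    using less that legal_move_smaller simple_graph_legal_move by blast
  show ?case
    using IH wins_own[of p G] wins_opponent[of "opponent p" G] by (cases p) auto
qed

end

(* Every position is a disjoint union of paths. With Right to move, Left keeps the number of
   components P_4 at most the number of components P_3. If Right turns P_4 into P_2 + P_2, there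
   was a P_3, which Left shrinks to P_2. Otherwise Right splits some P_(a+b) with a + b >= 5, and
   Left answers in P_a or P_b by the first available of P_4 -> P_3, P_3 -> P_2, P_5 -> P_2 + P_2,
   P_k -> P_(k-1) with k >= 6. *)

theory Submission
  imports Defs
begin

section \<open>Disjoint unions of paths\<close>

fun path_edges :: "'a list \<Rightarrow> 'a set set" where
  "path_edges (x # y # zs) = insert {x, y} (path_edges (y # zs))"
| "path_edges _ = {}"

definition linear_forest :: "'a list list \<Rightarrow> 'a graph" where
  "linear_forest Ls = Graph (set (concat Ls)) (\<Union> (path_edges ` set Ls))"

text \<open>Empty lists are admitted, so that deleting an end vertex needs no separate case.\<close>

definition proper :: "'a list list \<Rightarrow> bool" where
  "proper Ls \<longleftrightarrow> distinct (concat Ls) \<and> (\<forall>p\<in>set Ls. length p \<noteq> 1)"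

abbreviation num_paths :: "'a list list \<Rightarrow> nat \<Rightarrow> nat" where
  "num_paths Ls m \<equiv> count_list (map length Ls) m"

section \<open>Edges of a list under cutting\<close>

lemma path_edges_append:
  "path_edges (us @ x # vs) = path_edges (us @ [x]) \<union> path_edges (x # vs)"
  by (induction us rule: path_edges.induct) auto

lemma path_edges_subset: "e \<in> path_edges p \<Longrightarrow> e \<subseteq> set p"
  by (induction p rule: path_edges.induct) auto

lemma card_path_edges: "distinct p \<Longrightarrow> e \<in> path_edges p \<Longrightarrow> card e = 2"
  by (induction p rule: path_edges.induct) auto

lemma path_edges_ends_with: "e \<in> path_edges (us @ [x]) \<Longrightarrow> e \<in> path_edges us \<or> x \<in> e"
  by (induction us rule: path_edges.induct) auto

lemma path_edges_starts_with: "e \<in> path_edges (x # vs) \<Longrightarrow> e \<in> path_edges vs \<or> x \<in> e"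
  by (cases vs) auto

lemma path_edges_mono_left: "path_edges us \<subseteq> path_edges (us @ [x])"
  by (induction us rule: path_edges.induct) auto

lemma path_edges_mono_right: "path_edges vs \<subseteq> path_edges (x # vs)"
  by (cases vs) auto

text \<open>Every edge of the list lies inside \<open>us\<close>, lies inside \<open>vs\<close> or
  contains \<open>x\<close>; distinctness keeps \<open>x\<close> out of the first two kinds.\<close>

lemma path_edges_delete_vertex:
  assumes "distinct (us @ x # vs)"
  shows "{e \<in> path_edges (us @ x # vs). x \<notin> e} = path_edges us \<union> path_edges vs"
proof -
  have "x \<notin> e" if "e \<in> path_edges us \<or> e \<in> path_edges vs" for e
    using assms that path_edges_subset[of e us] path_edges_subset[of e vs] by auto
  then show ?thesis
    using path_edges_append[of us x vs] path_edges_ends_with[of _ us x]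
      path_edges_starts_with[of _ x vs] path_edges_mono_left[of us x] path_edges_mono_right[of vs x]
    by blast
qed

text \<open>Distinctness makes \<open>{x, y}\<close> occur only once: \<open>y\<close> is missing
  from \<open>us @ [x]\<close>, and \<open>x\<close> from \<open>y # vs\<close>.\<close>

lemma path_edges_delete_edge:
  assumes "distinct (us @ x # y # vs)"
  shows "path_edges (us @ x # y # vs) - {{x, y}} = path_edges (us @ [x]) \<union> path_edges (y # vs)"
proof -
  have "{x, y} \<notin> path_edges (us @ [x])" "{x, y} \<notin> path_edges (y # vs)"
    using assms path_edges_subset[of "{x, y}" "us @ [x]"] path_edges_subset[of "{x, y}" "y # vs"]
    by auto
  then show ?thesis
    by (subst path_edges_append) auto
qed

lemma path_edgesE:
  assumes "e \<in> path_edges p"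
  obtains us x y vs where "p = us @ x # y # vs" "e = {x, y}"
proof -
  have "\<exists>us x y vs. p = us @ x # y # vs \<and> e = {x, y}"
    using assms
  proof (induction p rule: path_edges.induct)
    case (1 x y zs)
    then show ?case
      by simp (metis append_Cons append_Nil)
  qed auto
  then show ?thesis
    using that by blast
qed

lemma path_edges_cover:
  assumes "v \<in> set p" "length p \<noteq> 1"
  shows "\<exists>e\<in>path_edges p. v \<in> e"
  using assms
proof (induction p rule: path_edges.induct)
  case (1 x y zs)
  then show ?case
    \<comment> \<open>For empty \<open>zs\<close> the tail is a singleton, which the induction
      hypothesis does not reach; there \<open>{x, y}\<close> covers both vertices.\<close>
    by (cases zs) auto
qed auto

lemma path_edges_upt: "path_edges [m..<n] = {{i, Suc i} | i. m \<le> i \<and> Suc i < n}"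
proof (induction "n - m" arbitrary: m)
  case (Suc d)
  show ?case
  proof (cases "Suc m < n")
    case True
    then have "path_edges [m..<n] = insert {m, Suc m} (path_edges [Suc m..<n])"
      by (simp add: upt_conv_Cons)
    moreover have "d = n - Suc m"
      using Suc.hyps by simp
    ultimately show ?thesis
      using Suc.hyps(1)[of "Suc m"] True by (auto simp: Suc_le_eq le_less)
  next
    case False
    then have "n = Suc m"
      using Suc.hyps by simp
    then show ?thesis
      by auto
  qed
qed auto

section \<open>Isolated vertices and deletions in unions of paths\<close>

lemma path_graph_linear_forest: "path_graph n = linear_forest [[0..<n]]"
  by (simp add: path_graph_def linear_forest_def path_edges_upt atLeast_upt)

lemma simple_linear_forest:
  assumes "distinct (concat Ls)"
  shows "simple_graph (linear_forest Ls)"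
proof -
  have "e \<subseteq> set (concat Ls) \<and> card e = 2" if "p \<in> set Ls" "e \<in> path_edges p" for p e
    using assms that path_edges_subset[of e p] card_path_edges[of p e]
    by (auto simp: distinct_concat_iff)
  then show ?thesis
    by (auto simp: simple_graph_def linear_forest_def)
qed

lemma isolated_linear_forest:
  assumes "distinct (concat Ls)"
  shows "isolated (linear_forest Ls) v \<longleftrightarrow>
    v \<in> set (concat Ls) \<and> (\<forall>p\<in>set Ls. \<forall>e\<in>path_edges p. v \<notin> e)"
proof -
  have "edges (linear_forest Ls) \<subseteq> Pow (verts (linear_forest Ls))"
    "finite (verts (linear_forest Ls))"
    using simple_linear_forest[OF assms] by (auto simp: simple_graph_def)
  then have "finite (edges (linear_forest Ls))"
    using finite_subset by blast
  then show ?thesis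
    by (auto simp: isolated_def degree_def linear_forest_def)
qed

text \<open>Each vertex has a neighbour in its own list. Hence any deletion that results in a proper
  list of paths is legal.\<close>

lemma proper_no_isolated:
  assumes "proper Ls"
  shows "\<not> isolated (linear_forest Ls) v"
proof
  assume "isolated (linear_forest Ls) v"
  then obtain p where "p \<in> set Ls" "v \<in> set p" "\<forall>e\<in>path_edges p. v \<notin> e"
    using assms isolated_linear_forest[of Ls v] by (auto simp: proper_def)
  then show False
    using assms path_edges_cover[of v p] by (auto simp: proper_def)
qed

text \<open>Needed to exclude cuts by Right that split off a single vertex.\<close>

lemma singleton_isolated:
  assumes "distinct (concat (As @ [v] # Bs))"
  shows "isolated (linear_forest (As @ [v] # Bs)) v"
proof -
  have "v \<notin> e" if "p \<in> set As \<union> set Bs" "e \<in> path_edges p" for p e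
    using assms that path_edges_subset[of e p] by auto
  then show ?thesis
    using isolated_linear_forest[OF assms] by auto
qed

lemma delete_vertex_linear_forest:
  assumes "distinct (concat (As @ (us @ x # vs) # Bs))"
  shows "delete_vertex (linear_forest (As @ (us @ x # vs) # Bs)) x
    = linear_forest (As @ us # vs # Bs)"
proof -
  have "x \<notin> e" if "e \<in> path_edges p" "p \<in> set As \<union> set Bs" for e p
    using assms that path_edges_subset[of e p] by auto
  moreover have "{e \<in> path_edges (us @ x # vs). x \<notin> e} = path_edges us \<union> path_edges vs"
    using assms by (intro path_edges_delete_vertex) auto
  ultimately have
    "{e \<in> \<Union> (path_edges ` set (As @ (us @ x # vs) # Bs)). x \<notin> e}
      = \<Union> (path_edges ` set (As @ us # vs # Bs))"
    by auto
  moreover have "set (concat (As @ (us @ x # vs) # Bs)) - {x} = set (concat (As @ us # vs # Bs))"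
    using assms by auto
  ultimately show ?thesis
    by (simp add: delete_vertex_def linear_forest_def)
qed

lemma delete_edge_linear_forest:
  assumes "distinct (concat (As @ (us @ x # y # vs) # Bs))"
  shows "delete_edge (linear_forest (As @ (us @ x # y # vs) # Bs)) {x, y}
    = linear_forest (As @ (us @ [x]) # (y # vs) # Bs)"
proof -
  have "{x, y} \<notin> path_edges p" if "p \<in> set As \<union> set Bs" for p
    using assms that path_edges_subset[of "{x, y}" p] by auto
  moreover have
    "path_edges (us @ x # y # vs) - {{x, y}} = path_edges (us @ [x]) \<union> path_edges (y # vs)"
    using assms by (intro path_edges_delete_edge) auto
  ultimately have
    "\<Union> (path_edges ` set (As @ (us @ x # y # vs) # Bs)) - {{x, y}}
      = \<Union> (path_edges ` set (As @ (us @ [x]) # (y # vs) # Bs))"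
    by auto
  then show ?thesis
    by (auto simp: delete_edge_def linear_forest_def)
qed

section \<open>Moves\<close>

text \<open>The strategy sees a move only through its effect on the counts. The equation is kept
  additive because subtraction on naturals truncates, and it also covers
  \<open>u = v\<close>.\<close>

lemma left_move:
  assumes "proper Ls" "num_paths Ls (u + 1 + v) > 0" "u \<noteq> 1" "v \<noteq> 1"
  obtains Ls' where "proper Ls'" "linear_forest Ls' \<in> legal_moves Left (linear_forest Ls)"
    "\<And>m. num_paths Ls' m + of_bool (m = u + 1 + v)
      = num_paths Ls m + of_bool (m = u) + of_bool (m = v)"
proof -
  obtain p where p: "p \<in> set Ls" "length p = u + 1 + v"
    using assms(2) count_list_0_iff[of "map length Ls" "u + 1 + v"] by auto
  obtain As Bs where Ls: "Ls = As @ p # Bs"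
    using p(1) by (meson split_list)
  \<comment> \<open>The deleted vertex is the one with exactly \<open>u\<close> predecessors on the
    path.\<close>
  define us x vs where "us = take u p" "x = p ! u" "vs = drop (Suc u) p"
  have p_eq: "p = us @ x # vs" and len: "length us = u" "length vs = v"
    using p(2) by (simp_all add: us_x_vs_def id_take_nth_drop)
  let ?Ls' = "As @ us # vs # Bs"
  have "proper ?Ls'"
    using assms(1,3,4) len by (auto simp: proper_def Ls p_eq)
  moreover have "delete_vertex (linear_forest Ls) x = linear_forest ?Ls'"
    using assms(1) delete_vertex_linear_forest[of As us x vs Bs] by (simp add: proper_def Ls p_eq)
  moreover have "x \<in> verts (linear_forest Ls)"
    by (simp add: linear_forest_def Ls p_eq)
  ultimately have "linear_forest ?Ls' \<in> legal_moves Left (linear_forest Ls)"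
    using proper_no_isolated[of ?Ls'] by (force simp: legal_moves_def creates_isolated_def)
  then show ?thesis
    using \<open>proper ?Ls'\<close> by (rule_tac that[of ?Ls']) (auto simp: Ls p_eq len)
qed

lemma right_move:
  assumes "proper Ls" "H \<in> legal_moves Right (linear_forest Ls)"
  obtains Ls' a b where "proper Ls'" "H = linear_forest Ls'" "a \<ge> 2" "b \<ge> 2"
    "\<And>m. num_paths Ls' m + of_bool (m = a + b)
      = num_paths Ls m + of_bool (m = a) + of_bool (m = b)"
proof -
  obtain p e where p: "p \<in> set Ls" "e \<in> path_edges p" "H = delete_edge (linear_forest Ls) e"
    using assms(2) by (auto simp: legal_moves_def linear_forest_def)
  obtain us x y vs where p_eq: "p = us @ x # y # vs" "e = {x, y}"
    using p(2) by (rule path_edgesE)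
  obtain As Bs where Ls: "Ls = As @ p # Bs"
    using p(1) by (meson split_list)
  let ?Ls' = "As @ (us @ [x]) # (y # vs) # Bs"
  have distinct: "distinct (concat ?Ls')"
    using assms(1) by (auto simp: proper_def Ls p_eq)
  have H: "H = linear_forest ?Ls'"
    using assms(1) delete_edge_linear_forest[of As us x y vs Bs]
    by (simp add: proper_def p(3) Ls p_eq)
  have no_isolated: "\<not> isolated H z" for z
    using assms(2) proper_no_isolated[OF assms(1)]
    by (auto simp: legal_moves_def creates_isolated_def)
  \<comment> \<open>Otherwise \<open>x\<close> would form a component of its own and be isolated in
    \<open>H\<close>; likewise \<open>y\<close> below.\<close>
  have "us \<noteq> []"
    using no_isolated[of x] singleton_isolated[of As x "(y # vs) # Bs"] distinct H by auto
  moreover have "vs \<noteq> []"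
    using no_isolated[of y] singleton_isolated[of "As @ [us @ [x]]" y Bs] distinct H by auto
  ultimately show ?thesis
    using assms(1) distinct H
    by (intro that[of ?Ls' "Suc (length us)" "Suc (length vs)"])
      (auto simp: proper_def Ls p_eq Suc_le_eq)
qed

section \<open>The strategy\<close>

text \<open>Since \<open>a + b \<ge> 4\<close>, a cut by Right never destroys a P_3. So the balance
  suffers only from new components P_4, while cutting a P_4 improves it by one.\<close>

lemma left_reply:
  assumes "proper Ls" "num_paths Ls 4 \<le> num_paths Ls 3"
    and "H \<in> legal_moves Right (linear_forest Ls)"
  obtains Ls' where "proper Ls'" "num_paths Ls' 4 \<le> num_paths Ls' 3"
    "linear_forest Ls' \<in> legal_moves Left H"
proof -
  note result = that
  obtain Ks a b where K: "proper Ks" "H = linear_forest Ks" "a \<ge> 2" "b \<ge> 2"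
    and num: "\<And>m. num_paths Ks m + of_bool (m = a + b)
      = num_paths Ls m + of_bool (m = a) + of_bool (m = b)"
    using right_move[OF assms(1,3)] by metis
  \<comment> \<open>\<open>balance\<close> is the invariant after Left splits P_(u+1+v), with the
    removed path moved to the other side of the inequality.\<close>
  have reply: thesis
    if legal: "num_paths Ks (u + 1 + v) > 0" "u \<noteq> 1" "v \<noteq> 1"
      and balance: "num_paths Ks 4 + of_bool (4 = u) + of_bool (4 = v) + of_bool (3 = u + 1 + v)
        \<le> num_paths Ks 3 + of_bool (3 = u) + of_bool (3 = v) + of_bool (4 = u + 1 + v)" for u v
  proof -
    obtain Ls' where L: "proper Ls'" "linear_forest Ls' \<in> legal_moves Left (linear_forest Ks)"
      and num': "\<And>m. num_paths Ls' m + of_bool (m = u + 1 + v)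
        = num_paths Ks m + of_bool (m = u) + of_bool (m = v)"
      using left_move[OF K(1) legal] by metis
    have "num_paths Ls' 4 \<le> num_paths Ls' 3"
      using balance num'[of 3] num'[of 4] by linarith
    with L K(2) show thesis
      by (intro result) auto
  qed
  consider (four) "a = 4 \<or> b = 4" | (three) "a = 2 \<and> b = 2 \<or> a = 3 \<or> b = 3" "a \<noteq> 4" "b \<noteq> 4"
    | (large) m where "m = a \<or> m = b" "m \<ge> 5" "a \<noteq> 3" "b \<noteq> 3" "a \<noteq> 4" "b \<noteq> 4"
    using K(3,4) by fastforce
  then show thesis
  proof cases
    \<comment> \<open>P_4 -> P_3 shifts the balance by two, just enough for the worst case
      \<open>a = b = 4\<close>.\<close>
    case four
    then show thesis
      using num[of 3] num[of 4] assms(2) K(3,4) by (intro reply[of 0 3]) auto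
  next
    \<comment> \<open>P_3 -> P_2 costs one P_3. It is paid for by the P_4 lost when
      \<open>a = b = 2\<close>, and otherwise by the P_3 just created.\<close>
    case three
    then show thesis
      using num[of 3] num[of 4] assms(2) K(3,4) by (intro reply[of 0 2]) (auto simp flip: numeral_3_eq_3)
  next
    \<comment> \<open>The cut leaves both counts unchanged, and so must the reply. P_5 -> P_4 would
      not, so P_5 loses its middle vertex; for \<open>m \<ge> 6\<close> the shortened path still has
      at least 5 vertices.\<close>
    case large
    then have "num_paths Ks m > 0" "num_paths Ks 4 \<le> num_paths Ks 3"
      using num[of 3] num[of 4] num[of m] assms(2) K(3,4) by auto
    then show thesis
      using large(2) reply[of 2 2] reply[of 0 "m - 1"] by (cases "m = 5") auto
  qed
qed

text \<open>Each round restores the invariant on a smaller graph. If Right has no legal move,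
  \<open>wins_opponent\<close> holds vacuously.\<close>

lemma left_wins_second:
  assumes "proper Ls" "num_paths Ls 4 \<le> num_paths Ls 3"
  shows "wins Left Right (linear_forest Ls)"
  using assms
proof (induction "card (verts (linear_forest Ls)) + card (edges (linear_forest Ls))"
    arbitrary: Ls rule: less_induct)
  case less
  have simple: "simple_graph (linear_forest Ls)"
    using less.prems by (simp add: proper_def simple_linear_forest)
  have "wins Left Left H" if H: "H \<in> legal_moves Right (linear_forest Ls)" for H
  proof -
    obtain Ls' where L: "proper Ls'" "num_paths Ls' 4 \<le> num_paths Ls' 3"
      "linear_forest Ls' \<in> legal_moves Left H"
      using left_reply[OF less.prems H] by metis
    have "wins Left Right (linear_forest Ls')"
      \<comment> \<open>The measure drops twice, once for Right's move and once for Left's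
        reply.\<close>
      using legal_move_smaller[OF simple H] simple_graph_legal_move[OF simple H]
        legal_move_smaller[OF _ L(3)] L(1,2)
      by (intro less.hyps) auto
    then show ?thesis
      using L(3) wins_own[of Left H] by auto
  qed
  then show ?case
    using wins_opponent[of Left] by auto
qed

theorem theorem3p4:
  fixes n :: nat and first :: player
  assumes "n \<ge> 5"
  shows "wins Left first (path_graph n)"
proof (cases first)
  case Left
  \<comment> \<open>The opening move must leave no P_4: P_5 is split into P_2 + P_2, and a longer
    path loses an end vertex.\<close>
  obtain u v where uv: "n = u + 1 + v" "u \<noteq> 1" "v \<noteq> 1" "u \<noteq> 4" "v \<noteq> 4"
  proof (cases "n = 5")
    case True
    then show ?thesis
      using that[of 2 2] by simp
  next
    case False
    then show ?thesis
      using assms that[of 0 "n - 1"] by simp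
  qed
  have "proper [[0..<n]]"
    using assms by (simp add: proper_def)
  then obtain Ls where L: "proper Ls" "linear_forest Ls \<in> legal_moves Left (path_graph n)"
    and num: "\<And>m. num_paths Ls m + of_bool (m = u + 1 + v)
      = num_paths [[0..<n]] m + of_bool (m = u) + of_bool (m = v)"
    using left_move[of "[[0..<n]]" u v] uv by (auto simp: path_graph_linear_forest)
  have "num_paths Ls 4 = 0"
    using num[of 4] uv assms by auto
  then have "wins Left Right (linear_forest Ls)"
    using L(1) by (intro left_wins_second) auto
  then show ?thesis
    using L(2) Left wins_own[of Left] by auto
next
  case Right
  \<comment> \<open>A single path with \<open>n \<ge> 5\<close> contains no component P_4, so the
    invariant holds at the start.\<close>
  then show ?thesis
    using assms by (auto simp: path_graph_linear_forest proper_def intro!: left_wins_second)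
qed

end
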